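(* Let $(X,\mathcal F)$ be a lamination on a compact Polish space, and let $\Lambda$ be a transverse invariant measure of $\mathcal F$ which is regular and finite on compact sets and satisfies $\operatorname{Cat}(\mathcal F,\Lambda)=0$. Let $\mathcal U$ be a finite regular foliated atlas of $\mathcal F$, let $\Gamma$ be the holonomy pseudogroup defined by $\mathcal U$, and let $S^{\mathcal U}$ be the finite symmetric system of generators of $\Gamma$ defined by $\mathcal U$. Then $$\operatorname{Cat}_{\mathrm{II}}(\mathcal F,\Lambda)\leq \operatorname{growth}_{S^{\mathcal U},\Lambda}(\Gamma).$$
   Context: **Laminations.** A foliated chart of a Polish space $X$ is a pair $(U,\varphi)$ with $U\subset X$ open and $\varphi:U\to B^n\times S$ a homeomorphism, where $B^n$ is an open ball of $\mathbb R^n$ and $S$ is Polish; its plaques are the sets corresponding to $B^n\times\{s\}$, its associated transversals correspond to $\{\ast\}\times S$, and $U\to S$ is its associated projection. A foliated atlas is a family of foliated charts $(U_i,\varphi_i)$ covering $X$ whose changes of coordinates are locally of the form $(x,s)\mapsto(f_{ij}(x,s),g_{ij}(s))$. A lamination $\mathcal F$ on $X$ is a maximal foliated atlas. The plaques form a base of the leaf topology, whose connected components are the leaves. A foliated atlas is regular if: (a) it is locally finite; (b) if a plaque $P$ of a chart $U_i$ meets another chart $U_j$, then $P\cap U_j$ is contained in only one plaque of $U_j$; (c) if $U_i\cap U_j\ne\emptyset$, there is a foliated chart $(V,\psi)$ with $U_i\cup U_j\subset V$, $\varphi_i=\psi|_{U_i}$, $\varphi_j=\psi|_{U_j}$. For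 a regular atlas, the maps $g_{ij}$ generate a pseudogroup $\Gamma$ on $T=\bigsqcup_i S_i$, the holonomy pseudogroup defined by the atlas; $S^{\mathcal U}$ is the set of these maps $g_{ij}$, made symmetric (closed under inversion and containing the identity maps on the domains and images of its elements). A transversal is a subset $T\subset X$ such that the projection of every chart $U$ restricts to a local homeomorphism $U\cap T\to S$; it is complete if it meets every leaf. A transverse invariant measure $\Lambda$ is a measure on the space of a representative of the holonomy pseudogroup (e.g. on a complete transversal), invariant by its local transformations; it extends to all transverse sets (measurable sets meeting each leaf in a countable set), invariantly under measurable transformations keeping each point in its leaf. A measure is regular if the measure of each measurable set $B$ is the infimum of the measures of open sets containing $B$ and the supremum of the measures of compact sets contained in $B$. **$\Lambda$-category.** For $U\subset X$ open, $\mathcal F_U$ is the restriction of $\mathcal F$ to $U$, and $U\times\mathbb R$ is foliated by the products of leaves of $\mathcal F_U$ with $\mathbb R$. A tangential deformation of $U$ is a continuous foliated map (taking leaves into leaves) $H:U\times\mathbb R\to X$ with $H(-,0)$ the inclusion. It is a tangential contraction if $H(-,1)$ is constant on each leaf of $\mathcal F_U$; then $U$ is called tangentially categorical, and $H(U\times\{1\})$ is a transverse set. Put $\tau_\Lambda(U)=\inf_H\Lambda(H(U\times\{1\}))$ over tangential contractions $H$ of $U$, and $\operatorname{Cat}(\mathcal F,\Lambda)=\inf_{\mathcal V}\sum_{U\in\mathcal V}\tau_\Lambda(U)$ over coverings $\mathcal V$ of $X$ by tangentially categorical open sets. **Secondary $\Lambda$-category.** Fix a finite regular atlas $\mathcal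 U$. A chain of plaques is a finite sequence of plaques of charts of $\mathcal U$, each meeting the next one; its length is its number of elements plus one. The length of a path in a leaf is the minimum length of a chain of plaques covering it; the length of a tangential deformation is the supremum of the lengths of the leafwise paths $t\mapsto H(x,t)$, $t\in[0,1]$. $\operatorname{Cat}(\mathcal F,\Lambda,n,\mathcal U)$ is defined like $\operatorname{Cat}(\mathcal F,\Lambda)$ using only tangential contractions of length $\le n$; when $\operatorname{Cat}(\mathcal F,\Lambda)=0$ it is regarded as a non-increasing sequence of positive numbers converging to $0$ (with $1/\infty=0$). **Growth types.** For non-decreasing $g,h:\mathbb N\to[0,\infty)$, $\mathbb N=\{1,2,\dots\}$, write $g\preceq h$ if there are $B\in\mathbb N$, $A>0$ with $g(n)\le A\,h(Bn)$ for all $n$; $g\simeq h$ means $g\preceq h\preceq g$. Classes $[g]$ are growth types, partially ordered by $\le$ induced by $\preceq$. $\operatorname{Cat}_{\mathrm{II}}(\mathcal F,\Lambda)=[1/\operatorname{Cat}(\mathcal F,\Lambda,n,\mathcal U)]$, which does not depend on the finite regular atlas $\mathcal U$. **$\Lambda$-growth.** For a pseudogroup $\Gamma$ with finite symmetric generating set $S$ (generation by composition, restriction to open sets and combination), $S_n$ is the set of transformations that are compositions of at most $n$ elements of $S$, and $\operatorname{growth}_S(\Gamma)=[\#S_n]$. If $\Lambda$ is a $\Gamma$-invariant measure on $T$ with support $K$ (a $\Gamma$-invariant closed set), then $\Gamma_\Lambda$ is the pseudogroup induced on $K$, $S^\Lambda$ is the symmetric set of generators of $\Gamma_\Lambda$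 induced by $S$, and $\operatorname{growth}_{S,\Lambda}(\Gamma)=\operatorname{growth}_{S^\Lambda}(\Gamma_\Lambda)$. *)

theory Defs
  imports "HOL-Analysis.Analysis"
begin

section \<open>Laminations\<close>

text \<open>A chart is a pair \<open>(U, \<phi>)\<close>; the values of \<open>\<phi>\<close> off \<open>U\<close> are irrelevant. The leaf factor lives in a
  Euclidean space \<open>'e\<close> (so \<open>n\<close> is its dimension), the transverse factor \<open>S\<close> is a subset
  of \<open>nat \<Rightarrow> real\<close> with the product topology. As every Polish space is homeomorphic to a closed
  subset of this space, every Polish transverse factor is covered.\<close>

type_synonym ('x, 'e) chart = "'x set \<times> ('x \<Rightarrow> 'e \<times> (nat \<Rightarrow> real))"

abbreviation chart_dom :: "('x, 'e) chart \<Rightarrow> 'x set" where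
  "chart_dom c \<equiv> fst c"

abbreviation chart_map :: "('x, 'e) chart \<Rightarrow> 'x \<Rightarrow> 'e \<times> (nat \<Rightarrow> real)" where
  "chart_map c \<equiv> snd c"

definition chart_proj :: "('x, 'e) chart \<Rightarrow> 'x \<Rightarrow> (nat \<Rightarrow> real)" where
  "chart_proj c x = snd (chart_map c x)"

text \<open>For a foliated chart this is the factor \<open>S\<close>, balls being nonempty.\<close>

definition chart_transversal :: "('x, 'e) chart \<Rightarrow> (nat \<Rightarrow> real) set" where
  "chart_transversal c = chart_proj c ` chart_dom c"

definition polish_subspace :: "'b::topological_space set \<Rightarrow> bool" where
  "polish_subspace S \<longleftrightarrow>
     completely_metrizable_space (top_of_set S) \<and> second_countable (top_of_set S)"

definition foliated_chart :: "('x::polish_space, 'e::euclidean_space) chart \<Rightarrow> bool" where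
  "foliated_chart c \<longleftrightarrow> open (chart_dom c) \<and>
     (\<exists>z r S \<psi>. r > 0 \<and> polish_subspace S \<and>
        homeomorphism (chart_dom c) (ball z r \<times> S) (chart_map c) \<psi>)"

definition plaques :: "('x, 'e) chart \<Rightarrow> 'x set set" where
  "plaques c = (\<lambda>s. {x \<in> chart_dom c. chart_proj c x = s}) ` chart_transversal c"

text \<open>The change of coordinates is locally of the form \<open>(x, s) \<mapsto> (f (x, s), g s)\<close>.\<close>

definition charts_compatible ::
    "('x::polish_space, 'e::euclidean_space) chart \<Rightarrow> ('x, 'e) chart \<Rightarrow> bool" where
  "charts_compatible c d \<longleftrightarrow>
     (\<forall>p \<in> chart_dom c \<inter> chart_dom d.
        \<exists>W f g. open W \<and> p \<in> W \<and> W \<subseteq> chart_dom c \<inter> chart_dom d \<and>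
          (\<forall>q\<in>W. chart_map d q = (f (chart_map c q), g (chart_proj c q))))"

definition foliated_atlas :: "('x::polish_space, 'e::euclidean_space) chart set \<Rightarrow> bool" where
  "foliated_atlas A \<longleftrightarrow> (\<forall>c\<in>A. foliated_chart c) \<and> (\<Union>c\<in>A. chart_dom c) = UNIV \<and>
     (\<forall>c\<in>A. \<forall>d\<in>A. charts_compatible c d)"

definition lamination :: "('x::polish_space, 'e::euclidean_space) chart set \<Rightarrow> bool" where
  "lamination F \<longleftrightarrow> foliated_atlas F \<and> (\<forall>A. foliated_atlas A \<and> F \<subseteq> A \<longrightarrow> A = F)"

definition leaf_topology :: "('x, 'e) chart set \<Rightarrow> 'x topology" where
  "leaf_topology F = topology_generated_by (\<Union>c\<in>F. plaques c)"

definition leaves :: "('x, 'e) chart set \<Rightarrow> 'x set set" where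
  "leaves F = connected_components_of (leaf_topology F)"

text \<open>The restriction to an open set \<open>U\<close>: by maximality of \<open>F\<close>, its charts are the charts of
  \<open>F\<close> lying in \<open>U\<close>, and the topology they generate as above has underlying set \<open>U\<close>.\<close>

definition restrict_lamination :: "('x, 'e) chart set \<Rightarrow> 'x set \<Rightarrow> ('x, 'e) chart set" where
  "restrict_lamination F U = {c \<in> F. chart_dom c \<subseteq> U}"


section \<open>Regular atlases and the holonomy pseudogroup\<close>

text \<open>\<open>c\<close> is the restriction of \<open>v\<close> to the domain of \<open>c\<close>, up to a change of coordinates
  \<open>(x, s) \<mapsto> (f (x, s), g s)\<close> with \<open>g\<close> injective on the whole transverse factor of \<open>c\<close>; so the
  plaques of \<open>c\<close> are the traces on \<open>c\<close> of plaques of \<open>v\<close>. Literal equality of coordinates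
  is not what is meant: if the maps of meeting charts agreed on the overlaps, the leaf coordinates
  would glue to a continuous map from the space to \<open>'e\<close>, open on plaques, which does not exist on
  a compact space.\<close>

definition chart_restricts ::
    "('x::polish_space, 'e::euclidean_space) chart \<Rightarrow> ('x, 'e) chart \<Rightarrow> bool" where
  "chart_restricts v c \<longleftrightarrow> chart_dom c \<subseteq> chart_dom v \<and>
     (\<exists>f g. inj_on g (chart_transversal c) \<and>
        (\<forall>p\<in>chart_dom c. chart_map v p = (f (chart_map c p), g (chart_proj c p))))"

definition regular_atlas ::
    "('x::polish_space, 'e::euclidean_space) chart set \<Rightarrow> ('x, 'e) chart set \<Rightarrow> bool" where
  "regular_atlas F \<U> \<longleftrightarrow> \<U> \<subseteq> F \<and> foliated_atlas \<U> \<and>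
     (\<forall>x. \<exists>W. open W \<and> x \<in> W \<and> finite {c\<in>\<U>. chart_dom c \<inter> W \<noteq> {}}) \<and>
     (\<forall>c\<in>\<U>. \<forall>d\<in>\<U>. \<forall>P\<in>plaques c. P \<inter> chart_dom d \<noteq> {} \<longrightarrow>
        (\<exists>!P'. P' \<in> plaques d \<and> P \<inter> chart_dom d \<subseteq> P')) \<and>
     (\<forall>c\<in>\<U>. \<forall>d\<in>\<U>. chart_dom c \<inter> chart_dom d \<noteq> {} \<longrightarrow>
        (\<exists>v\<in>F. chart_restricts v c \<and> chart_restricts v d))"

text \<open>The disjoint union \<open>T\<close> of the transverse factors of the charts of the atlas.\<close>

type_synonym ('x, 'e) tpoint = "('x, 'e) chart \<times> (nat \<Rightarrow> real)"

definition transverse_space :: "('x, 'e) chart set \<Rightarrow> ('x, 'e) tpoint topology" where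
  "transverse_space \<U> = sum_topology (\<lambda>c. top_of_set (chart_transversal c)) \<U>"

text \<open>Local transformations of \<open>T\<close> are represented by their graphs, so that composition,
  inversion and restriction are those of relations. The following is the graph of \<open>g\<^sub>c\<^sub>d\<close>; it is
  single-valued when the atlas is regular.\<close>

definition holonomy_map ::
    "('x, 'e) chart \<Rightarrow> ('x, 'e) chart \<Rightarrow> ('x, 'e) tpoint rel" where
  "holonomy_map c d =
     (\<lambda>x. ((c, chart_proj c x), (d, chart_proj d x))) ` (chart_dom c \<inter> chart_dom d)"

definition symmetric_hull :: "'t rel set \<Rightarrow> 't rel set" where
  "symmetric_hull S =
     S \<union> converse ` S \<union> (\<lambda>r. Id_on (Domain r)) ` S \<union> (\<lambda>r. Id_on (Range r)) ` S"

definition holonomy_generators :: "('x, 'e) chart set \<Rightarrow> ('x, 'e) tpoint rel set" where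
  "holonomy_generators \<U> = symmetric_hull
     {holonomy_map c d | c d. c \<in> \<U> \<and> d \<in> \<U> \<and> chart_dom c \<inter> chart_dom d \<noteq> {}}"

inductive_set generated_pseudogroup :: "'t topology \<Rightarrow> 't rel set \<Rightarrow> 't rel set"
  for T S where
  generator: "r \<in> S \<Longrightarrow> r \<in> generated_pseudogroup T S"
| composition: "\<lbrakk>r \<in> generated_pseudogroup T S; q \<in> generated_pseudogroup T S\<rbrakk>
    \<Longrightarrow> r O q \<in> generated_pseudogroup T S"
| restriction: "\<lbrakk>r \<in> generated_pseudogroup T S; openin T W\<rbrakk>
    \<Longrightarrow> r \<inter> (W \<times> UNIV) \<in> generated_pseudogroup T S"
| combination: "\<lbrakk>\<And>r. r \<in> R \<Longrightarrow> r \<in> generated_pseudogroup T S;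
      single_valued (\<Union>R); single_valued ((\<Union>R)\<inverse>)\<rbrakk>
    \<Longrightarrow> \<Union>R \<in> generated_pseudogroup T S"

definition holonomy_pseudogroup :: "('x, 'e) chart set \<Rightarrow> ('x, 'e) tpoint rel set" where
  "holonomy_pseudogroup \<U> =
     generated_pseudogroup (transverse_space \<U>) (holonomy_generators \<U>)"


section \<open>Transverse invariant measures\<close>

definition borel_measure_on :: "'t topology \<Rightarrow> 't measure \<Rightarrow> bool" where
  "borel_measure_on T M \<longleftrightarrow> space M = topspace T \<and>
     sets M = sigma_sets (topspace T) {W. openin T W}"

definition pseudogroup_invariant :: "'t rel set \<Rightarrow> 't measure \<Rightarrow> bool" where
  "pseudogroup_invariant \<Gamma> M \<longleftrightarrow>
     (\<forall>h\<in>\<Gamma>. \<forall>B\<in>sets M. B \<subseteq> Domain h \<longrightarrow> emeasure M (h `` B) = emeasure M B)"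

text \<open>A transverse invariant measure, given on the representative of the holonomy
  pseudogroup defined by the atlas \<open>\<U>\<close>.\<close>

definition transverse_invariant_measure ::
    "('x, 'e) chart set \<Rightarrow> ('x, 'e) tpoint measure \<Rightarrow> bool" where
  "transverse_invariant_measure \<U> M \<longleftrightarrow> borel_measure_on (transverse_space \<U>) M \<and>
     pseudogroup_invariant (holonomy_pseudogroup \<U>) M"

definition regular_measure :: "'t topology \<Rightarrow> 't measure \<Rightarrow> bool" where
  "regular_measure T M \<longleftrightarrow> (\<forall>B\<in>sets M.
     emeasure M B = (INF W\<in>{W. openin T W \<and> B \<subseteq> W}. emeasure M W) \<and>
     emeasure M B = (SUP K\<in>{K. compactin T K \<and> K \<subseteq> B}. emeasure M K))"

definition finite_on_compacts :: "'t topology \<Rightarrow> 't measure \<Rightarrow> bool" where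
  "finite_on_compacts T M \<longleftrightarrow> (\<forall>K. compactin T K \<longrightarrow> emeasure M K < \<infinity>)"

text \<open>The extension of \<open>M\<close> to transverse sets. A Borel set meeting each leaf in a countable set is
  a countable disjoint union of Borel pieces, each contained in a chart of the atlas and projected
  injectively onto a Borel subset of its transverse factor (Lusin--Novikov). The projection of a piece
  moves points within their leaves, so the extension must be the sum of the measures of the projected
  pieces. By invariance of \<open>M\<close> this sum is the same for all decompositions; the infimum only serves to
  pick the common value.\<close>

definition transverse_decomposition ::
    "('x::polish_space, 'e) chart set \<Rightarrow> ('x, 'e) tpoint measure \<Rightarrow> 'x set \<Rightarrow>
     (nat \<Rightarrow> ('x, 'e) chart) \<Rightarrow> (nat \<Rightarrow> 'x set) \<Rightarrow> bool" where
  "transverse_decomposition \<U> M Q c D \<longleftrightarrow>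
     disjoint_family D \<and> (\<Union>k. D k) = Q \<and>
     (\<forall>k. c k \<in> \<U> \<and> D k \<in> sets borel \<and> D k \<subseteq> chart_dom (c k) \<and>
        inj_on (chart_proj (c k)) (D k) \<and> {c k} \<times> chart_proj (c k) ` D k \<in> sets M)"

definition transverse_measure ::
    "('x::polish_space, 'e) chart set \<Rightarrow> ('x, 'e) tpoint measure \<Rightarrow> 'x set \<Rightarrow> ennreal" where
  "transverse_measure \<U> M Q =
     (INF (c, D) \<in> {(c, D). transverse_decomposition \<U> M Q c D}.
        \<Sum>k. emeasure M ({c k} \<times> chart_proj (c k) ` D k))"

definition measure_support :: "'t topology \<Rightarrow> 't measure \<Rightarrow> 't set" where
  "measure_support T M =
     {t \<in> topspace T. \<forall>W. openin T W \<and> t \<in> W \<longrightarrow> emeasure M W > 0}"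


section \<open>\<open>\<Lambda>\<close>-category\<close>

definition tangential_deformation ::
    "('x::polish_space, 'e) chart set \<Rightarrow> 'x set \<Rightarrow> ('x \<times> real \<Rightarrow> 'x) \<Rightarrow> bool" where
  "tangential_deformation F U H \<longleftrightarrow> continuous_on (U \<times> UNIV) H \<and>
     (\<forall>L\<in>leaves (restrict_lamination F U). \<exists>L'\<in>leaves F. H ` (L \<times> UNIV) \<subseteq> L') \<and>
     (\<forall>x\<in>U. H (x, 0) = x)"

definition tangential_contractions ::
    "('x::polish_space, 'e) chart set \<Rightarrow> 'x set \<Rightarrow> ('x \<times> real \<Rightarrow> 'x) set" where
  "tangential_contractions F U = {H. tangential_deformation F U H \<and>
     (\<forall>L\<in>leaves (restrict_lamination F U). \<exists>y. \<forall>x\<in>L. H (x, 1) = y)}"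

text \<open>The category computed with the contractions of \<open>U\<close> restricted to \<open>C U\<close>.\<close>

definition category_via ::
    "('x::topological_space set \<Rightarrow> ('x \<times> real \<Rightarrow> 'x) set) \<Rightarrow> ('x set \<Rightarrow> ennreal) \<Rightarrow> ennreal" where
  "category_via C \<Lambda> =
     (INF \<V> \<in> {\<V>. \<Union>\<V> = UNIV \<and> (\<forall>U\<in>\<V>. open U \<and> C U \<noteq> {})}.
        \<Sum>\<^sub>\<infinity>U\<in>\<V>. (INF H\<in>C U. \<Lambda> (H ` (U \<times> {1}))))"

definition Cat ::
    "('x::polish_space, 'e) chart set \<Rightarrow> ('x set \<Rightarrow> ennreal) \<Rightarrow> ennreal" where
  "Cat F \<Lambda> = category_via (tangential_contractions F) \<Lambda>"

definition plaque_chain :: "('x, 'e) chart set \<Rightarrow> 'x set list \<Rightarrow> bool" where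
  "plaque_chain \<U> Ps \<longleftrightarrow> Ps \<noteq> [] \<and> set Ps \<subseteq> (\<Union>c\<in>\<U>. plaques c) \<and>
     successively (\<lambda>P P'. P \<inter> P' \<noteq> {}) Ps"

definition path_length :: "('x, 'e) chart set \<Rightarrow> (real \<Rightarrow> 'x) \<Rightarrow> enat" where
  "path_length \<U> \<gamma> =
     (INF Ps \<in> {Ps. plaque_chain \<U> Ps \<and> \<gamma> ` {0..1} \<subseteq> \<Union>(set Ps)}. enat (length Ps + 1))"

definition deformation_length ::
    "('x, 'e) chart set \<Rightarrow> 'x set \<Rightarrow> ('x \<times> real \<Rightarrow> 'x) \<Rightarrow> enat" where
  "deformation_length \<U> U H = (SUP x\<in>U. path_length \<U> (\<lambda>t. H (x, t)))"

definition Cat_upto ::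
    "('x::polish_space, 'e) chart set \<Rightarrow> ('x set \<Rightarrow> ennreal) \<Rightarrow> nat \<Rightarrow> ('x, 'e) chart set \<Rightarrow> ennreal"
  where
  "Cat_upto F \<Lambda> n \<U> =
     category_via (\<lambda>U. {H \<in> tangential_contractions F U. deformation_length \<U> U H \<le> enat n}) \<Lambda>"


section \<open>Growth types\<close>

text \<open>Functions on \<open>{1, 2, \<dots>}\<close>; the value at \<open>0\<close> plays no role.\<close>

definition growth_function :: "(nat \<Rightarrow> real) \<Rightarrow> bool" where
  "growth_function g \<longleftrightarrow> (\<forall>n\<ge>1. 0 \<le> g n) \<and> (\<forall>m\<ge>1. \<forall>n\<ge>m. g m \<le> g n)"

definition growth_dominated :: "(nat \<Rightarrow> real) \<Rightarrow> (nat \<Rightarrow> real) \<Rightarrow> bool" where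
  "growth_dominated g h \<longleftrightarrow> (\<exists>B\<ge>1. \<exists>A>0. \<forall>n\<ge>1. g n \<le> A * h (B * n))"

definition growth_type :: "(nat \<Rightarrow> real) \<Rightarrow> (nat \<Rightarrow> real) set" where
  "growth_type g = {h. growth_function h \<and> growth_dominated g h \<and> growth_dominated h g}"

definition growth_type_le :: "(nat \<Rightarrow> real) set \<Rightarrow> (nat \<Rightarrow> real) set \<Rightarrow> bool" where
  "growth_type_le G H \<longleftrightarrow> (\<exists>g\<in>G. \<exists>h\<in>H. growth_dominated g h)"

text \<open>Here \<open>1 / \<infinity> = 0\<close>; this is meant for sequences of positive \<open>Cat_upto\<close>, since
  \<^const>\<open>enn2real\<close> sends \<open>1 / 0 = \<infinity>\<close> to \<open>0\<close>.\<close>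

definition Cat_II ::
    "('x::polish_space, 'e) chart set \<Rightarrow> ('x set \<Rightarrow> ennreal) \<Rightarrow> ('x, 'e) chart set \<Rightarrow>
     (nat \<Rightarrow> real) set" where
  "Cat_II F \<Lambda> \<U> = growth_type (\<lambda>n. enn2real (1 / Cat_upto F \<Lambda> n \<U>))"

definition compositions_upto :: "'t rel set \<Rightarrow> nat \<Rightarrow> 't rel set" where
  "compositions_upto S n =
     {foldr (O) rs Id | rs. set rs \<subseteq> S \<and> 1 \<le> length rs \<and> length rs \<le> n}"

text \<open>The growth depends on the pseudogroup only through the generating set.\<close>

definition pseudogroup_growth :: "'t rel set \<Rightarrow> (nat \<Rightarrow> real) set" where
  "pseudogroup_growth S = growth_type (\<lambda>n. real (card (compositions_upto S n)))"

definition induced_generators :: "'t set \<Rightarrow> 't rel set \<Rightarrow> 't rel set" where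
  "induced_generators K S = (\<lambda>r. r \<inter> (K \<times> K)) ` S"

definition measure_growth ::
    "'t topology \<Rightarrow> 't rel set \<Rightarrow> 't measure \<Rightarrow> (nat \<Rightarrow> real) set" where
  "measure_growth T S M = pseudogroup_growth (induced_generators (measure_support T M) S)"

end

theory Submission
  imports Defs
begin

text \<open>Write \<open>T\<close> for the disjoint union of the transverse factors, \<open>K \<subseteq> T\<close> for the support of
  the measure \<open>M\<close>, and \<open>N\<^sub>n\<close> for the number of compositions of at most \<open>n\<close> generators induced
  on \<open>K\<close>. The inequality of growth types comes from the estimate
  \<open>M T \<le> N\<^sub>n * Cat_upto n\<close>: the total mass is a constant, so \<open>1 / Cat_upto n\<close> is at most
  \<open>N\<^sub>n / M T\<close>.

  The estimate says that a contraction by paths of length at most \<open>n\<close> cannot compress the mass of \<open>T\<close>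
  by more than the factor \<open>N\<^sub>n\<close>. Let \<open>H\<close> contract \<open>U\<close> and let \<open>x \<in> U\<close>
  represent a point \<open>t \<in> K\<close>. A chain of fewer than \<open>n\<close> plaques covers the path from \<open>x\<close> to
  \<open>y = H (x, 1)\<close>; crossing from each plaque to the next one is a holonomy map, and two more of them adjust
  the charts in which \<open>x\<close> and \<open>y\<close> are read. So a composition \<open>h\<close> of at most \<open>n\<close> holonomy maps
  sends \<open>t\<close> to a projection of \<open>y\<close> (\<open>plaque_chain_holonomy\<close>), and \<open>h\<close> may be formed on
  \<open>K\<close>, since \<open>K\<close> is invariant (\<open>support_invariant\<close>). Hence the traces on \<open>K\<close> of the points
  represented in \<open>U\<close> are covered by the preimages, under \<open>N\<^sub>n\<close> maps, of the projected pieces of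
  \<open>H (U \<times> {1})\<close>. Each of these maps preserves \<open>M\<close>, so taking a preimage does not increase the
  measure (\<open>contracts_preimages_composition\<close>), and the points represented in \<open>U\<close> have measure at
  most \<open>N\<^sub>n\<close> times that of \<open>H (U \<times> {1})\<close> (\<open>chart_trace_measure_le\<close>). By compactness finitely
  many sets \<open>U\<close> of a covering suffice, and \<open>K\<close> has full measure, so summing gives the estimate.

  It yields nothing if \<open>M\<close> vanishes; but then the transverse measure, and with it \<open>Cat_upto\<close>, takes
  only the values \<open>0\<close> and \<open>\<infinity>\<close>, so a positive \<open>Cat_upto\<close> has reciprocal \<open>0\<close>.\<close>

section \<open>Projections of foliated charts\<close>

lemma chart_proj_open_map:
  fixes c :: "('x::polish_space, 'e::euclidean_space) chart"
  assumes c: "foliated_chart c" and V: "open V" "V \<subseteq> chart_dom c"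
  shows "openin (top_of_set (chart_transversal c)) (chart_proj c ` V)"
proof -
  obtain z r S \<psi> where r: "r > 0"
    and hom: "homeomorphism (chart_dom c) (ball z r \<times> S) (chart_map c) \<psi>"
    using c unfolding foliated_chart_def by (elim conjE exE) (rule that)
  have im: "chart_map c ` chart_dom c = ball z r \<times> S"
    using hom by (simp add: homeomorphism_def)
  have S: "chart_transversal c = S"
  proof -
    have "chart_transversal c = snd ` (chart_map c ` chart_dom c)"
      by (simp add: chart_transversal_def chart_proj_def image_image)
    then show ?thesis using r by (simp add: im)
  qed
  have "openin (top_of_set (chart_dom c)) V"
    using V by (metis open_openin openin_subset_trans subset_UNIV subtopology_UNIV)
  then have "openin (top_of_set (ball z r \<times> S)) (chart_map c ` V)"
    by (rule homeomorphism_imp_open_map[OF hom])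
  then obtain G where G: "open G" "chart_map c ` V = (ball z r \<times> S) \<inter> G"
    by (auto simp: openin_open)
  have "chart_proj c ` V = snd ` (chart_map c ` V)"
    by (simp add: chart_proj_def image_image)
  also have "\<dots> = S \<inter> snd ` (G \<inter> (ball z r \<times> UNIV))"
    unfolding G(2) by force
  finally have *: "chart_proj c ` V = S \<inter> snd ` (G \<inter> (ball z r \<times> UNIV))" .
  have "open (snd ` (G \<inter> (ball z r \<times> UNIV)))"
    by (intro open_image_snd open_Int G open_Times) auto
  then show ?thesis
    unfolding S * by (auto simp: openin_open)
qed

lemma chart_proj_continuous:
  fixes c :: "('x::polish_space, 'e::euclidean_space) chart"
  assumes c: "foliated_chart c" and W: "openin (top_of_set (chart_transversal c)) W"
  shows "open {x \<in> chart_dom c. chart_proj c x \<in> W}"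
proof -
  obtain z r S \<psi> where
    hom: "homeomorphism (chart_dom c) (ball z r \<times> S) (chart_map c) \<psi>"
    and op: "open (chart_dom c)"
    using c unfolding foliated_chart_def by (elim conjE exE) (rule that)
  have "continuous_on (chart_dom c) (chart_proj c)"
    unfolding chart_proj_def using hom
    by (auto simp: homeomorphism_def intro: continuous_on_snd)
  moreover obtain G where G: "open G" "W = chart_transversal c \<inter> G"
    using W by (auto simp: openin_open)
  ultimately have "open (chart_dom c \<inter> chart_proj c -` G)"
    using op by (metis continuous_on_open_vimage inf_commute)
  moreover have "{x \<in> chart_dom c. chart_proj c x \<in> W} = chart_dom c \<inter> chart_proj c -` G"
    unfolding G(2) chart_transversal_def by auto
  ultimately show ?thesis by simp
qed

section \<open>Relations whose preimages do not increase a measure\<close>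

text \<open>An inequality, because preservation of the measure would be lost on cutting a relation down to a
  measurable set; the inequality survives both this and composition.\<close>

definition contracts_preimages :: "'t measure \<Rightarrow> 't rel \<Rightarrow> bool" where
  "contracts_preimages M q \<longleftrightarrow>
     (\<forall>E\<in>sets M. q\<inverse> `` E \<in> sets M \<and> emeasure M (q\<inverse> `` E) \<le> emeasure M E)"

lemma contracts_preimages_relcomp:
  assumes "contracts_preimages M p" "contracts_preimages M q"
  shows "contracts_preimages M (p O q)"
  using assms unfolding contracts_preimages_def converse_relcomp relcomp_Image
  by (meson order_trans)

lemma contracts_preimages_composition:
  assumes "\<And>r. r \<in> S \<Longrightarrow> contracts_preimages M r" "h \<in> compositions_upto S n"
  shows "contracts_preimages M h"
proof -
  have "contracts_preimages M (foldr (O) rs Id)" if "set rs \<subseteq> S" for rs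
    using that
  proof (induction rs)
    case Nil
    then show ?case by (simp add: contracts_preimages_def)
  next
    case (Cons r rs)
    then show ?case using contracts_preimages_relcomp assms(1) by auto
  qed
  then show ?thesis using assms(2) unfolding compositions_upto_def by blast
qed

lemma contracts_preimages_restrict:
  assumes "contracts_preimages M r" "K \<in> sets M"
  shows "contracts_preimages M (r \<inter> (K \<times> K))"
  unfolding contracts_preimages_def
proof
  fix E assume E: "E \<in> sets M"
  have eq: "(r \<inter> (K \<times> K))\<inverse> `` E = K \<inter> r\<inverse> `` (E \<inter> K)" by auto
  have EK: "E \<inter> K \<in> sets M" using E assms(2) by blast
  have r: "r\<inverse> `` (E \<inter> K) \<in> sets M"
    "emeasure M (r\<inverse> `` (E \<inter> K)) \<le> emeasure M (E \<inter> K)"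
    using assms(1) EK unfolding contracts_preimages_def by auto
  have "emeasure M (K \<inter> r\<inverse> `` (E \<inter> K)) \<le> emeasure M (r\<inverse> `` (E \<inter> K))"
    using r(1) by (intro emeasure_mono) auto
  also have "\<dots> \<le> emeasure M (E \<inter> K)" by (rule r(2))
  also have "\<dots> \<le> emeasure M E" using E by (intro emeasure_mono) auto
  finally show "(r \<inter> (K \<times> K))\<inverse> `` E \<in> sets M \<and>
      emeasure M ((r \<inter> (K \<times> K))\<inverse> `` E) \<le> emeasure M E"
    using r(1) assms(2) unfolding eq by auto
qed

section \<open>Compositions of generators\<close>

lemma finite_compositions_upto:
  assumes "finite S"
  shows "finite (compositions_upto S n)"
proof -
  have "compositions_upto S n \<subseteq> (\<lambda>rs. foldr (O) rs Id) ` {rs. set rs \<subseteq> S \<and> length rs \<le> n}"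
    unfolding compositions_upto_def by auto
  then show ?thesis
    using finite_lists_length_le[OF assms] finite_subset by blast
qed

lemma compositions_upto_mono: "m \<le> n \<Longrightarrow> compositions_upto S m \<subseteq> compositions_upto S n"
  unfolding compositions_upto_def by fastforce

lemma foldr_relcomp_restrict:
  assumes "(t, t') \<in> foldr (O) rs Id" "t \<in> K"
    and "\<And>r t t'. r \<in> set rs \<Longrightarrow> (t, t') \<in> r \<Longrightarrow> t \<in> K \<Longrightarrow> t' \<in> K"
  shows "(t, t') \<in> foldr (O) (map (\<lambda>r. r \<inter> (K \<times> K)) rs) Id"
  using assms
proof (induction rs arbitrary: t)
  case Nil
  then show ?case by simp
next
  case (Cons r rs)
  then obtain u where u: "(t, u) \<in> r" "(u, t') \<in> foldr (O) rs Id" by auto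
  then have "u \<in> K" using Cons.prems by auto
  then show ?case using Cons u by (auto intro!: relcompI)
qed

section \<open>Plaque chains and holonomy\<close>

definition holonomy_maps :: "('x, 'e) chart set \<Rightarrow> ('x, 'e) tpoint rel set" where
  "holonomy_maps \<U> =
     {holonomy_map c d | c d. c \<in> \<U> \<and> d \<in> \<U> \<and> chart_dom c \<inter> chart_dom d \<noteq> {}}"

lemma holonomy_mapsI:
  assumes "c \<in> \<U>" "d \<in> \<U>" "x \<in> chart_dom c" "x \<in> chart_dom d"
  shows "holonomy_map c d \<in> holonomy_maps \<U>"
  using assms unfolding holonomy_maps_def by blast

lemma holonomy_mapI:
  assumes "x \<in> chart_dom c" "x \<in> chart_dom d"
  shows "((c, chart_proj c x), (d, chart_proj d x)) \<in> holonomy_map c d"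
  using assms unfolding holonomy_map_def by auto

text \<open>One holonomy map passes from the chart of \<open>x\<close> to that of the first plaque, one is needed for
  each crossing, and one passes from the last plaque to the chart of \<open>y\<close>. The chain may be
  left at any of its plaques, so that the place of \<open>y\<close> along it is arbitrary.\<close>

lemma plaque_chain_holonomy_from_hd:
  assumes "set (P # Ps) \<subseteq> (\<Union>c\<in>\<U>. plaques c)"
    and "successively (\<lambda>P P'. P \<inter> P' \<noteq> {}) (P # Ps)"
    and "x \<in> P" "c \<in> \<U>" "x \<in> chart_dom c"
    and "y \<in> \<Union> (set (P # Ps))" "d \<in> \<U>" "y \<in> chart_dom d"
  shows "\<exists>rs. set rs \<subseteq> holonomy_maps \<U>
     \<and> 1 \<le> length rs \<and> length rs \<le> Suc (length (P # Ps))
     \<and> ((c, chart_proj c x), (d, chart_proj d y)) \<in> foldr (O) rs Id"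
  using assms
proof (induction Ps arbitrary: P x c)
  case Nil
  then obtain e where e: "e \<in> \<U>" "P \<in> plaques e" by auto
  then obtain s where P: "P = {x \<in> chart_dom e. chart_proj e x = s}"
    unfolding plaques_def by blast
  have "y \<in> P" using Nil.prems by simp
  then have xy: "x \<in> chart_dom e" "y \<in> chart_dom e" "chart_proj e x = chart_proj e y"
    using Nil.prems(3) unfolding P by auto
  have "((c, chart_proj c x), (d, chart_proj d y)) \<in> foldr (O) [holonomy_map c e, holonomy_map e d] Id"
    using holonomy_mapI[of x c e] holonomy_mapI[of y e d] xy Nil.prems by (auto intro!: relcompI)
  moreover have "set [holonomy_map c e, holonomy_map e d] \<subseteq> holonomy_maps \<U>"
    using holonomy_mapsI[of c \<U> e x] holonomy_mapsI[of e \<U> d y] xy Nil.prems e by auto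
  ultimately show ?case
    by (intro exI[of _ "[holonomy_map c e, holonomy_map e d]"]) simp
next
  case (Cons P2 Ps)
  then obtain e where e: "e \<in> \<U>" "P \<in> plaques e" by auto
  then obtain s where P: "P = {x \<in> chart_dom e. chart_proj e x = s}"
    unfolding plaques_def by blast
  have xe: "x \<in> chart_dom e" using Cons.prems(3) P by auto
  have ce: "holonomy_map c e \<in> holonomy_maps \<U>" using holonomy_mapsI[of c \<U> e x] xe Cons.prems e by auto
  show ?case
  proof (cases "y \<in> P")
    case True
    then have xy: "y \<in> chart_dom e" "chart_proj e x = chart_proj e y"
      using Cons.prems(3) unfolding P by auto
    have "((c, chart_proj c x), (d, chart_proj d y)) \<in> foldr (O) [holonomy_map c e, holonomy_map e d] Id"
      using holonomy_mapI[of x c e] holonomy_mapI[of y e d] xe xy Cons.prems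
      by (auto intro!: relcompI)
    moreover have "set [holonomy_map c e, holonomy_map e d] \<subseteq> holonomy_maps \<U>"
      using ce holonomy_mapsI[of e \<U> d y] xy Cons.prems e by auto
    ultimately show ?thesis
      by (intro exI[of _ "[holonomy_map c e, holonomy_map e d]"]) simp
  next
    case False
    obtain z where z: "z \<in> P" "z \<in> P2" using Cons.prems(2) by auto
    then have ze: "z \<in> chart_dom e" "chart_proj e x = chart_proj e z"
      using Cons.prems(3) unfolding P by auto
    obtain rs where rs: "set rs \<subseteq> holonomy_maps \<U>" "1 \<le> length rs" "length rs \<le> Suc (length (P2 # Ps))"
      "((e, chart_proj e z), (d, chart_proj d y)) \<in> foldr (O) rs Id"
      using Cons.IH[of P2 z e] Cons.prems z ze e False by auto
    have "((c, chart_proj c x), (d, chart_proj d y)) \<in> foldr (O) (holonomy_map c e # rs) Id"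
      using holonomy_mapI[of x c e] xe ze rs(4) Cons.prems by (auto intro!: relcompI)
    then show ?thesis
      using rs ce by (intro exI[of _ "holonomy_map c e # rs"]) simp
  qed
qed

lemma plaque_chain_holonomy:
  assumes Ps: "plaque_chain \<U> Ps"
    and x: "x \<in> \<Union> (set Ps)" "c \<in> \<U>" "x \<in> chart_dom c"
    and y: "y \<in> \<Union> (set Ps)" "d \<in> \<U>" "y \<in> chart_dom d"
  obtains rs where
    "set rs \<subseteq> holonomy_maps \<U>"
    "1 \<le> length rs" "length rs \<le> Suc (length Ps)"
    "((c, chart_proj c x), (d, chart_proj d y)) \<in> foldr (O) rs Id"
proof -
  obtain P where P: "x \<in> P" "P \<in> set Ps" using x by blast
  then obtain as bs where split: "Ps = as @ P # bs" by (meson split_list)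
  have pl: "set Ps \<subseteq> (\<Union>c\<in>\<U>. plaques c)" and su: "successively (\<lambda>P P'. P \<inter> P' \<noteq> {}) Ps"
    using Ps unfolding plaque_chain_def by auto
  \<comment> \<open>The plaque of \<open>y\<close> comes after or before that of \<open>x\<close>; in the second case the chain is
    read backwards.\<close>
  obtain Qs where Qs: "set (P # Qs) \<subseteq> set Ps" "length (P # Qs) \<le> length Ps"
    "successively (\<lambda>P P'. P \<inter> P' \<noteq> {}) (P # Qs)" "y \<in> \<Union> (set (P # Qs))"
  proof (cases "y \<in> \<Union> (set (P # bs))")
    case True
    then show ?thesis using that[of bs] su unfolding split
      by (auto simp: successively_append_iff)
  next
    case False
    then have "y \<in> \<Union> (set (P # rev as))" using y(1) split by auto
    moreover have "successively (\<lambda>P P'. P \<inter> P' \<noteq> {}) (P # rev as)"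
    proof -
      have "successively (\<lambda>P P'. P \<inter> P' \<noteq> {}) (as @ [P])"
        using su unfolding split by (auto simp: successively_append_iff)
      then have "successively (\<lambda>P P'. P' \<inter> P \<noteq> {}) (rev (as @ [P]))"
        by (simp only: successively_rev)
      then show ?thesis by (simp add: Int_commute)
    qed
    ultimately show ?thesis using that[of "rev as"] unfolding split by auto
  qed
  show ?thesis
    using plaque_chain_holonomy_from_hd[of P Qs \<U> x c y d] Qs pl P(1) x y that
    by (meson Suc_le_mono order_trans)
qed

section \<open>Holonomy maps and the support of the measure\<close>

locale holonomy_measure =
  fixes F \<U> :: "('x::polish_space, 'e::euclidean_space) chart set"
    and M :: "('x, 'e) tpoint measure"
  assumes regular: "regular_atlas F \<U>" and finite_atlas: "finite \<U>"
    and invariant: "transverse_invariant_measure \<U> M"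
begin

abbreviation "T \<equiv> transverse_space \<U>"
abbreviation "S \<equiv> holonomy_generators \<U>"
abbreviation "K \<equiv> measure_support T M"
abbreviation "S\<^sub>K \<equiv> induced_generators K S"

lemma foliated_atlas: "foliated_atlas \<U>"
  using regular unfolding regular_atlas_def by (elim conjE)

lemma chart_foliated: "c \<in> \<U> \<Longrightarrow> foliated_chart c"
  using foliated_atlas unfolding foliated_atlas_def by (elim conjE) (rule bspec)

lemma chart_open: "c \<in> \<U> \<Longrightarrow> open (chart_dom c)"
  by (drule chart_foliated) (simp add: foliated_chart_def)

lemma charts_cover: "\<exists>c\<in>\<U>. x \<in> chart_dom c"
  using foliated_atlas unfolding foliated_atlas_def by (elim conjE) blast

lemma topspace_T: "topspace T = Sigma \<U> chart_transversal"
  unfolding transverse_space_def by (auto simp: o_def)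

lemma openin_T: "openin T W \<longleftrightarrow> W \<subseteq> Sigma \<U> chart_transversal \<and>
    (\<forall>c\<in>\<U>. openin (top_of_set (chart_transversal c)) {s. (c, s) \<in> W})"
  unfolding transverse_space_def openin_sum_topology by (simp add: o_def)

lemma space_M: "space M = topspace T"
  and sets_M: "sets M = sigma_sets (topspace T) {W. openin T W}"
  using invariant unfolding transverse_invariant_measure_def borel_measure_on_def by auto

lemma open_measurable: "openin T W \<Longrightarrow> W \<in> sets M"
  unfolding sets_M by (rule sigma_sets.Basic) simp

lemma openin_chart_piece:
  assumes "c \<in> \<U>" "openin (top_of_set (chart_transversal c)) W"
  shows "openin T ({c} \<times> W)"
proof -
  have "{s. (c', s) \<in> {c} \<times> W} = (if c' = c then W else {})" for c' by auto
  then show ?thesis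
    using assms openin_subset[OF assms(2)] unfolding openin_T by auto
qed

text \<open>For open \<open>V\<close> this is the part of \<open>T\<close> whose mass a contraction of \<open>V\<close> has to carry.
  It does not depend on the contraction, so a bound on its measure valid for every contraction passes to
  the infimum over all of them.\<close>

definition chart_trace :: "'x set \<Rightarrow> ('x, 'e) tpoint set" where
  "chart_trace V = (\<Union>c\<in>\<U>. {c} \<times> chart_proj c ` (V \<inter> chart_dom c))"

lemma openin_chart_trace:
  assumes "open V"
  shows "openin T (chart_trace V)"
  unfolding chart_trace_def
  by (intro openin_Union ballI)
     (auto intro!: openin_chart_piece chart_proj_open_map chart_foliated open_Int assms chart_open)

lemma chart_trace_cover:
  assumes "\<Union>\<V> = UNIV"
  shows "topspace T \<subseteq> (\<Union>V\<in>\<V>. chart_trace V)"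
  using assms unfolding topspace_T chart_trace_def chart_transversal_def by blast

text \<open>Points with the same projection lie in the same plaque of \<open>c\<close>, and in a regular atlas a plaque
  of \<open>c\<close> meets only one plaque of \<open>d\<close>.\<close>

lemma holonomy_map_single_valued:
  assumes cd: "c \<in> \<U>" "d \<in> \<U>"
  shows "single_valued (holonomy_map c d)"
proof -
  have plaque_condition: "\<forall>c\<in>\<U>. \<forall>d\<in>\<U>. \<forall>P\<in>plaques c. P \<inter> chart_dom d \<noteq> {} \<longrightarrow>
      (\<exists>!P'. P' \<in> plaques d \<and> P \<inter> chart_dom d \<subseteq> P')"
    using regular unfolding regular_atlas_def by (elim conjE)
  have agree: "chart_proj d x = chart_proj d y"
    if "x \<in> chart_dom c" "x \<in> chart_dom d" "y \<in> chart_dom c" "y \<in> chart_dom d"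
      "chart_proj c x = chart_proj c y" for x y
  proof -
    let ?P = "{z \<in> chart_dom c. chart_proj c z = chart_proj c x}"
    have "?P \<in> plaques c" using that unfolding plaques_def chart_transversal_def by blast
    moreover have "?P \<inter> chart_dom d \<noteq> {}" using that by blast
    ultimately have "\<exists>!P'. P' \<in> plaques d \<and> ?P \<inter> chart_dom d \<subseteq> P'"
      by (rule plaque_condition[rule_format, OF cd])
    then obtain P' where P': "P' \<in> plaques d" "?P \<inter> chart_dom d \<subseteq> P'"
      by (elim ex1E conjE)
    have "x \<in> P'" "y \<in> P'" using P'(2) that by auto
    then show ?thesis using P'(1) unfolding plaques_def by auto
  qed
  show ?thesis
  proof (rule single_valuedI)
    fix s t t' assume "(s, t) \<in> holonomy_map c d" "(s, t') \<in> holonomy_map c d"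
    then obtain x y where x: "x \<in> chart_dom c \<inter> chart_dom d"
        "(s, t) = ((c, chart_proj c x), (d, chart_proj d x))"
      and y: "y \<in> chart_dom c \<inter> chart_dom d"
        "(s, t') = ((c, chart_proj c y), (d, chart_proj d y))"
      unfolding holonomy_map_def by (elim imageE)
    then have "chart_proj d x = chart_proj d y" by (intro agree) simp_all
    then show "t = t'" using x(2) y(2) by simp
  qed
qed

lemma converse_holonomy_map: "(holonomy_map c d)\<inverse> = holonomy_map d c"
  unfolding holonomy_map_def by auto

text \<open>The preimages are projections, by the open map of \<open>c\<close>, of preimages under the continuous
  projection of \<open>d\<close>.\<close>

lemma holonomy_map_preimage_open:
  assumes cd: "c \<in> \<U>" "d \<in> \<U>" and W: "openin T W"
  shows "openin T ((holonomy_map c d)\<inverse> `` W)"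
proof -
  let ?V = "chart_dom c \<inter> {x \<in> chart_dom d. chart_proj d x \<in> {s. (d, s) \<in> W}}"
  have "open ?V"
    using W cd unfolding openin_T
    by (intro open_Int chart_open chart_proj_continuous chart_foliated) auto
  then have "openin T ({c} \<times> chart_proj c ` ?V)"
    using cd by (intro openin_chart_piece chart_proj_open_map chart_foliated) auto
  moreover have "(holonomy_map c d)\<inverse> `` W = {c} \<times> chart_proj c ` ?V"
    unfolding holonomy_map_def by auto
  ultimately show ?thesis by simp
qed

lemma generators_eq: "S = symmetric_hull (holonomy_maps \<U>)"
  unfolding holonomy_generators_def holonomy_maps_def ..

lemma holonomy_maps_generators: "holonomy_maps \<U> \<subseteq> S"
  unfolding generators_eq symmetric_hull_def by blast

lemma holonomy_maps_cases:
  assumes "r \<in> holonomy_maps \<U>"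
  obtains c d where "c \<in> \<U>" "d \<in> \<U>" "r = holonomy_map c d"
  using assms unfolding holonomy_maps_def by blast

lemma generator_cases:
  assumes "r \<in> S"
  obtains c d where "c \<in> \<U>" "d \<in> \<U>" "r = holonomy_map c d"
  | c d where "c \<in> \<U>" "d \<in> \<U>" "r = Id_on (Domain (holonomy_map c d))"
proof -
  consider q where "q \<in> holonomy_maps \<U>" "r = q" | q where "q \<in> holonomy_maps \<U>" "r = q\<inverse>"
    | q where "q \<in> holonomy_maps \<U>" "r = Id_on (Domain q)"
    | q where "q \<in> holonomy_maps \<U>" "r = Id_on (Range q)"
    using assms unfolding generators_eq symmetric_hull_def by blast
  then show ?thesis
    by cases (metis holonomy_maps_cases converse_holonomy_map Domain_converse that)+
qed

lemma converse_generator: "r \<in> S \<Longrightarrow> r\<inverse> \<in> S"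
  unfolding generators_eq symmetric_hull_def by (elim UnE imageE) auto

lemma generator_single_valued: "r \<in> S \<Longrightarrow> single_valued r"
  by (elim generator_cases) (auto simp: holonomy_map_single_valued)

lemma generator_preimage_open:
  assumes "r \<in> S" "openin T W"
  shows "openin T (r\<inverse> `` W)"
  using assms(1)
proof (cases rule: generator_cases)
  case (1 c d)
  then show ?thesis using holonomy_map_preimage_open assms by simp
next
  case (2 c d)
  have "Range (holonomy_map c d) \<subseteq> topspace T"
    unfolding topspace_T holonomy_map_def chart_transversal_def using 2 by auto
  then have "Domain (holonomy_map c d) = (holonomy_map c d)\<inverse> `` topspace T"
    by blast
  then have "openin T (Domain (holonomy_map c d))"
    using holonomy_map_preimage_open[OF 2(1,2) openin_topspace] by simp
  moreover have "r\<inverse> `` W = Domain (holonomy_map c d) \<inter> W" using 2 by auto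
  ultimately show ?thesis using assms by auto
qed

lemma generator_range: "r \<in> S \<Longrightarrow> Range r \<subseteq> topspace T"
  by (elim generator_cases)
     (auto simp: topspace_T holonomy_map_def chart_transversal_def)

lemma openin_generator_range:
  assumes "r \<in> S"
  shows "openin T (Range r)"
proof -
  have "Domain r \<subseteq> topspace T"
    using generator_range[OF converse_generator[OF assms]] by simp
  then have "Range r = (r\<inverse>)\<inverse> `` topspace T" by blast
  then show ?thesis
    using generator_preimage_open[OF converse_generator[OF assms] openin_topspace] by simp
qed

lemma generator_preimage_measurable:
  assumes r: "r \<in> S" and E: "E \<in> sets M"
  shows "r\<inverse> `` E \<in> sets M"
  using E unfolding sets_M
proof (induction rule: sigma_sets.induct)
  case (Basic W)
  then show ?case using generator_preimage_open[OF r] by (auto intro: sigma_sets.Basic)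
next
  case Empty
  then show ?case by (simp add: sigma_sets.Empty)
next
  case (Compl E)
  have "r\<inverse> `` (topspace T - E) = r\<inverse> `` topspace T - r\<inverse> `` E"
    using generator_single_valued[OF r] unfolding single_valued_def by blast
  moreover have "r\<inverse> `` topspace T \<in> sets M"
    using generator_preimage_open[OF r] open_measurable by blast
  ultimately show ?case using Compl.IH unfolding sets_M[symmetric] by auto
next
  case (Union E)
  have "r\<inverse> `` (\<Union>i. E i) = (\<Union>i. r\<inverse> `` E i)" by blast
  then show ?case using Union.IH by (simp add: sigma_sets.Union)
qed

text \<open>Only the part of \<open>E\<close> in the open range of \<open>r\<close> has preimages, and on it the converse
  of \<open>r\<close>, a generator too, preserves the measure.\<close>

lemma generator_contracts_preimages:
  assumes r: "r \<in> S"
  shows "contracts_preimages M r"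
  unfolding contracts_preimages_def
proof
  fix E assume E: "E \<in> sets M"
  have ER: "E \<inter> Range r \<in> sets M"
    using E openin_generator_range[OF r] open_measurable by blast
  have "r\<inverse> \<in> holonomy_pseudogroup \<U>"
    unfolding holonomy_pseudogroup_def
    using converse_generator[OF r] by (rule generated_pseudogroup.generator)
  then have "emeasure M (r\<inverse> `` (E \<inter> Range r)) = emeasure M (E \<inter> Range r)"
    using invariant ER
    unfolding transverse_invariant_measure_def pseudogroup_invariant_def by auto
  moreover have "r\<inverse> `` (E \<inter> Range r) = r\<inverse> `` E" by blast
  moreover have "emeasure M (E \<inter> Range r) \<le> emeasure M E"
    using E by (intro emeasure_mono) auto
  ultimately show "r\<inverse> `` E \<in> sets M \<and> emeasure M (r\<inverse> `` E) \<le> emeasure M E"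
    using generator_preimage_measurable[OF r E] by simp
qed

text \<open>A null neighbourhood of the image point would have a null open preimage around a point of the
  support.\<close>

lemma support_invariant:
  assumes r: "r \<in> S" and tt: "(t, t') \<in> r" and t: "t \<in> K"
  shows "t' \<in> K"
  unfolding measure_support_def
proof (intro CollectI conjI allI impI)
  show "t' \<in> topspace T" using generator_range[OF r] tt by blast
  fix W assume W: "openin T W \<and> t' \<in> W"
  then have "openin T (r\<inverse> `` W)" "t \<in> r\<inverse> `` W"
    using generator_preimage_open[OF r] tt by auto
  then have "0 < emeasure M (r\<inverse> `` W)" using t unfolding measure_support_def by blast
  also have "\<dots> \<le> emeasure M W"
    using generator_contracts_preimages[OF r] W open_measurable
    unfolding contracts_preimages_def by blast
  finally show "emeasure M W > 0" .
qed

text \<open>The complement of the support is a union of null open sets; countably many suffice since the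
  transverse factors are second countable.\<close>

lemma support_full_measure: "topspace T - K \<in> null_sets M"
proof -
  obtain B :: "(nat \<Rightarrow> real) set set" where B: "countable B" "topological_basis B"
    using ex_countable_basis by blast
  define N :: "('x, 'e) chart \<times> (nat \<Rightarrow> real) set \<Rightarrow> ('x, 'e) tpoint set"
    where "N = (\<lambda>(c, b). {c} \<times> (chart_transversal c \<inter> b))"
  define I where "I = {i \<in> \<U> \<times> B. emeasure M (N i) = 0}"
  have op: "openin T (N (c, b))" if "c \<in> \<U>" "b \<in> B" for c b
    unfolding N_def using that topological_basis_open[OF B(2)]
    by (auto intro!: openin_chart_piece)
  have "countable I"
    unfolding I_def using countable_SIGMA[OF countable_finite[OF finite_atlas] B(1)]
    by (rule countable_subset[rotated]) auto
  then have null: "(\<Union>i\<in>I. N i) \<in> null_sets M"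
    by (rule null_sets_UN') (use op open_measurable in \<open>auto simp: I_def null_sets_def\<close>)
  have "topspace T - K = (\<Union>i\<in>I. N i)"
  proof
    show "(\<Union>i\<in>I. N i) \<subseteq> topspace T - K"
    proof
      fix t assume "t \<in> (\<Union>i\<in>I. N i)"
      then obtain i where i: "i \<in> I" "t \<in> N i" by blast
      then have o: "openin T (N i)" and z: "emeasure M (N i) = 0"
        using op by (auto simp: I_def)
      have "t \<notin> K" unfolding measure_support_def using o z i(2) by force
      then show "t \<in> topspace T - K" using openin_subset[OF o] i(2) by blast
    qed
    show "topspace T - K \<subseteq> (\<Union>i\<in>I. N i)"
    proof
      fix t assume t: "t \<in> topspace T - K"
      then obtain W where W: "openin T W" "t \<in> W" "emeasure M W = 0"
        unfolding measure_support_def by (auto simp: not_less)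
      obtain c s where cs: "t = (c, s)" "c \<in> \<U>" "s \<in> chart_transversal c"
        using t unfolding topspace_T by auto
      obtain G where G: "open G" "{s. (c, s) \<in> W} = chart_transversal c \<inter> G"
        using W(1) cs(2) unfolding openin_T openin_open by blast
      have "s \<in> G" using G(2) W(2) cs(1) by blast
      then obtain b where b: "b \<in> B" "s \<in> b" "b \<subseteq> G"
        using G(1) B(2) topological_basisE by metis
      have "N (c, b) \<subseteq> W" unfolding N_def using b(3) G(2) by blast
      then have "emeasure M (N (c, b)) = 0"
        using W(1,3) open_measurable by (metis emeasure_mono le_zero_eq)
      then have "(c, b) \<in> I" unfolding I_def using cs b by simp
      moreover have "t \<in> N (c, b)" unfolding N_def using cs b by simp
      ultimately show "t \<in> (\<Union>i\<in>I. N i)" by blast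
    qed
  qed
  then show ?thesis using null by simp
qed

lemma support_measurable: "K \<in> sets M"
proof -
  have "K = space M - (topspace T - K)"
    unfolding space_M by (auto simp: measure_support_def)
  moreover have "space M - (topspace T - K) \<in> sets M"
    using support_full_measure by blast
  ultimately show ?thesis by simp
qed

section \<open>The mass estimate\<close>

lemma finite_induced_generators: "finite S\<^sub>K"
proof -
  have "holonomy_maps \<U> \<subseteq> (\<lambda>(c, d). holonomy_map c d) ` (\<U> \<times> \<U>)"
    unfolding holonomy_maps_def by fast
  then have "finite (holonomy_maps \<U>)"
    using finite_atlas by (meson finite_SigmaI finite_imageI finite_subset)
  then show ?thesis
    unfolding induced_generators_def generators_eq symmetric_hull_def by simp
qed

text \<open>A length of at most \<open>n\<close> means at most \<open>n - 1\<close> plaques, and passing along \<open>m\<close> plaques takes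
  at most \<open>m + 1\<close> holonomy maps: \<open>m - 1\<close> crossings and a change of charts at either end. So at
  most \<open>n\<close> factors are used. The intermediate points stay in the support
  by its invariance, which allows the generators to be cut down to it.\<close>

lemma contraction_endpoint_holonomy:
  assumes H: "tangential_deformation F U H" "deformation_length \<U> U H \<le> enat n"
    and x: "x \<in> U" "c \<in> \<U>" "x \<in> chart_dom c" and t: "(c, chart_proj c x) \<in> K"
    and d: "d \<in> \<U>" "H (x, 1) \<in> chart_dom d"
  shows "\<exists>h\<in>compositions_upto S\<^sub>K n. ((c, chart_proj c x), (d, chart_proj d (H (x, 1)))) \<in> h"
proof -
  have "path_length \<U> (\<lambda>t. H (x, t)) \<le> enat n"
    using H(2) x(1) unfolding deformation_length_def by (metis SUP_upper order_trans)
  \<comment> \<open>The infimum is attained: a value below \<open>n + 1\<close> occurs.\<close>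
  then have "path_length \<U> (\<lambda>t. H (x, t)) < enat (Suc n)"
    by (simp add: le_less_trans)
  then obtain Ps where Ps: "plaque_chain \<U> Ps" "(\<lambda>t. H (x, t)) ` {0..1} \<subseteq> \<Union> (set Ps)"
      "length Ps + 1 \<le> n"
    unfolding path_length_def INF_less_iff by auto
  have "H (x, 0) \<in> \<Union> (set Ps)" "H (x, 1) \<in> \<Union> (set Ps)"
    using Ps(2) by (auto simp: image_subset_iff)
  moreover have "H (x, 0) = x" using H(1) x(1) unfolding tangential_deformation_def by blast
  ultimately obtain rs where rs: "set rs \<subseteq> holonomy_maps \<U>" "1 \<le> length rs" "length rs \<le> Suc (length Ps)"
      "((c, chart_proj c x), (d, chart_proj d (H (x, 1)))) \<in> foldr (O) rs Id"
    using plaque_chain_holonomy[OF Ps(1) _ x(2,3) _ d] by auto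
  have S: "set rs \<subseteq> S" using rs(1) holonomy_maps_generators by blast
  let ?rs = "map (\<lambda>r. r \<inter> (K \<times> K)) rs"
  have "((c, chart_proj c x), (d, chart_proj d (H (x, 1)))) \<in> foldr (O) ?rs Id"
    by (rule foldr_relcomp_restrict[OF rs(4) t]) (use S support_invariant in blast)
  moreover have "set ?rs \<subseteq> S\<^sub>K" using S unfolding induced_generators_def by auto
  ultimately show ?thesis
    unfolding compositions_upto_def using rs Ps(3)
    by (intro bexI[of _ "foldr (O) ?rs Id"]) (auto intro!: exI[of _ ?rs])
qed

lemma compositions_nonempty:
  assumes "n \<ge> 1"
  shows "compositions_upto S\<^sub>K n \<noteq> {}"
proof -
  obtain c x where "c \<in> \<U>" "x \<in> chart_dom c" using charts_cover by blast
  then have "holonomy_map c c \<in> S"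
    by (intro subsetD[OF holonomy_maps_generators] holonomy_mapsI)
  then have "holonomy_map c c \<inter> (K \<times> K) \<in> S\<^sub>K"
    unfolding induced_generators_def by (rule imageI)
  then have "foldr (O) [holonomy_map c c \<inter> (K \<times> K)] Id \<in> compositions_upto S\<^sub>K n"
    unfolding compositions_upto_def using assms
    by (intro CollectI exI[of _ "[holonomy_map c c \<inter> (K \<times> K)]"]) auto
  then show ?thesis by blast
qed

text \<open>Each decomposition of the end set gives countably many pieces \<open>E k\<close> of \<open>T\<close>; their preimages
  under the compositions cover the trace up to the null complement of the support, and for each of the
  compositions the preimages have total measure at most that of the pieces.\<close>

lemma chart_trace_measure_le:
  assumes U: "open U" and n: "n \<ge> 1"
    and H: "tangential_deformation F U H" "deformation_length \<U> U H \<le> enat n"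
  shows "emeasure M (chart_trace U)
    \<le> of_nat (card (compositions_upto S\<^sub>K n)) * transverse_measure \<U> M (H ` (U \<times> {1}))"
proof -
  let ?C = "compositions_upto S\<^sub>K n"
  let ?N = "of_nat (card ?C) :: ennreal"
  have fin: "finite ?C" using finite_induced_generators by (rule finite_compositions_upto)
  have C: "contracts_preimages M h" if "h \<in> ?C" for h
  proof (rule contracts_preimages_composition[OF _ that])
    fix r assume "r \<in> S\<^sub>K"
    then show "contracts_preimages M r"
      unfolding induced_generators_def
      using contracts_preimages_restrict[OF generator_contracts_preimages support_measurable] by auto
  qed
  have le: "emeasure M (chart_trace U) \<le> ?N * (\<Sum>k. emeasure M ({c k} \<times> chart_proj (c k) ` D k))"
    if cD: "transverse_decomposition \<U> M (H ` (U \<times> {1})) c D" for c D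
  proof -
    define E where "E k = {c k} \<times> chart_proj (c k) ` D k" for k
    have E: "E k \<in> sets M" for k
      using cD unfolding transverse_decomposition_def E_def by blast
    have pre: "h\<inverse> `` E k \<in> sets M" "emeasure M (h\<inverse> `` E k) \<le> emeasure M (E k)"
      if "h \<in> ?C" for h k
      using C[OF that] E unfolding contracts_preimages_def by auto
    have cover: "chart_trace U \<subseteq> (topspace T - K) \<union> (\<Union>h\<in>?C. \<Union>k. h\<inverse> `` E k)"
    proof
      fix t assume t: "t \<in> chart_trace U"
      then obtain a x where x: "t = (a, chart_proj a x)" "a \<in> \<U>" "x \<in> U" "x \<in> chart_dom a"
        unfolding chart_trace_def by auto
      have "t \<in> topspace T" using t openin_subset[OF openin_chart_trace[OF U]] by blast
      moreover have "t \<in> (\<Union>h\<in>?C. \<Union>k. h\<inverse> `` E k)" if tK: "t \<in> K"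
      proof -
        have "H (x, 1) \<in> (\<Union>k. D k)"
          using cD x(3) unfolding transverse_decomposition_def by blast
        then obtain k where k: "H (x, 1) \<in> D k" by blast
        then have "c k \<in> \<U>" "H (x, 1) \<in> chart_dom (c k)"
          using cD unfolding transverse_decomposition_def by auto
        then obtain h where "h \<in> ?C" "(t, (c k, chart_proj (c k) (H (x, 1)))) \<in> h"
          using contraction_endpoint_holonomy[OF H x(3,2,4)] tK x(1) by blast
        moreover have "(c k, chart_proj (c k) (H (x, 1))) \<in> E k"
          unfolding E_def using k by blast
        ultimately show ?thesis by blast
      qed
      ultimately show "t \<in> (topspace T - K) \<union> (\<Union>h\<in>?C. \<Union>k. h\<inverse> `` E k)" by blast
    qed
    have ms: "(\<Union>h\<in>?C. \<Union>k. h\<inverse> `` E k) \<in> sets M"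
      using fin pre(1) by (intro sets.finite_UN sets.countable_UN) auto
    have "emeasure M (chart_trace U) \<le> emeasure M ((topspace T - K) \<union> (\<Union>h\<in>?C. \<Union>k. h\<inverse> `` E k))"
      using cover ms support_full_measure by (intro emeasure_mono) auto
    also have "\<dots> = emeasure M (\<Union>h\<in>?C. \<Union>k. h\<inverse> `` E k)"
      using emeasure_Un_null_set[OF ms support_full_measure] by (simp add: Un_commute)
    also have "\<dots> \<le> (\<Sum>h\<in>?C. emeasure M (\<Union>k. h\<inverse> `` E k))"
      using fin pre(1) by (intro emeasure_subadditive_finite) auto
    also have "\<dots> \<le> (\<Sum>h\<in>?C. \<Sum>k. emeasure M (E k))"
    proof (rule sum_mono)
      fix h assume h: "h \<in> ?C"
      have "emeasure M (\<Union>k. h\<inverse> `` E k) \<le> (\<Sum>k. emeasure M (h\<inverse> `` E k))"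
        using pre(1)[OF h] by (intro emeasure_subadditive_countably) auto
      also have "\<dots> \<le> (\<Sum>k. emeasure M (E k))"
        using pre(2)[OF h] by (intro suminf_le) auto
      finally show "emeasure M (\<Union>k. h\<inverse> `` E k) \<le> (\<Sum>k. emeasure M (E k))" .
    qed
    also have "\<dots> = ?N * (\<Sum>k. emeasure M (E k))" by simp
    finally show ?thesis unfolding E_def .
  qed
  have "card ?C > 0"
    using compositions_nonempty[OF n] fin by (simp add: card_gt_0_iff)
  then have N: "?N > 0" "?N \<noteq> 0" "?N \<noteq> top" by auto
  have "emeasure M (chart_trace U) / ?N \<le> transverse_measure \<U> M (H ` (U \<times> {1}))"
    unfolding transverse_measure_def
    by (rule INF_greatest) (auto intro!: divide_le_posI_ennreal N le)
  then have "?N * (emeasure M (chart_trace U) / ?N) \<le> ?N * transverse_measure \<U> M (H ` (U \<times> {1}))"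
    by (rule mult_left_mono) simp
  then show ?thesis
    using N by (simp add: ennreal_times_divide ennreal_mult_divide_eq mult.commute[of ?N])
qed

text \<open>A finite subcovering suffices, because a finite partial sum is at most the full sum. Dividing by the
  number of compositions first leaves the infima and sums free of constants.\<close>

lemma total_mass_le:
  assumes compact: "compact (UNIV :: 'x set)" and n: "n \<ge> 1"
  shows "emeasure M (space M)
    \<le> of_nat (card (compositions_upto S\<^sub>K n)) * Cat_upto F (transverse_measure \<U> M) n \<U>"
proof -
  let ?N = "of_nat (card (compositions_upto S\<^sub>K n)) :: ennreal"
  let ?C = "\<lambda>U. {H \<in> tangential_contractions F U. deformation_length \<U> U H \<le> enat n}"
  define \<tau> where "\<tau> U = (INF H\<in>?C U. transverse_measure \<U> M (H ` (U \<times> {1})))" for U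
  have "card (compositions_upto S\<^sub>K n) > 0"
    using compositions_nonempty[OF n] finite_compositions_upto[OF finite_induced_generators]
    by (simp add: card_gt_0_iff)
  then have N: "?N > 0" "?N \<noteq> 0" "?N \<noteq> top" by auto
  have piece: "emeasure M (chart_trace U) / ?N \<le> \<tau> U" if "open U" for U
    unfolding \<tau>_def using that
    by (intro INF_greatest divide_le_posI_ennreal N chart_trace_measure_le n)
       (auto simp: tangential_contractions_def)
  have "emeasure M (space M) / ?N \<le> infsum \<tau> \<V>"
    if \<V>: "\<Union>\<V> = UNIV" "\<forall>U\<in>\<V>. open U" for \<V>
  proof -
    obtain \<W> where \<W>: "\<W> \<subseteq> \<V>" "finite \<W>" "\<Union>\<W> = UNIV"
      using compactE[OF compact, of \<V>] \<V> by (metis top.extremum_unique)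
    have "emeasure M (space M) \<le> emeasure M (\<Union>U\<in>\<W>. chart_trace U)"
      using chart_trace_cover[OF \<W>(3)] \<W> \<V>(2) unfolding space_M
      by (intro emeasure_mono open_measurable openin_Union) (auto intro!: openin_chart_trace)
    also have "\<dots> \<le> (\<Sum>U\<in>\<W>. emeasure M (chart_trace U))"
      using \<W> \<V>(2)
      by (intro emeasure_subadditive_finite) (auto intro!: open_measurable openin_chart_trace)
    finally have "emeasure M (space M) / ?N \<le> (\<Sum>U\<in>\<W>. emeasure M (chart_trace U)) / ?N"
      by (rule divide_right_mono_ennreal)
    also have "\<dots> = (\<Sum>U\<in>\<W>. emeasure M (chart_trace U) / ?N)"
      by (simp add: divide_ennreal_def sum_distrib_right)
    also have "\<dots> \<le> sum \<tau> \<W>"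
      using \<W> \<V>(2) piece by (intro sum_mono) blast
    also have "\<dots> \<le> infsum \<tau> \<V>"
      using \<W> by (subst nonneg_infsum_complete) (auto intro: SUP_upper)
    finally show ?thesis .
  qed
  then have "emeasure M (space M) / ?N \<le> Cat_upto F (transverse_measure \<U> M) n \<U>"
    unfolding Cat_upto_def category_via_def \<tau>_def by (intro INF_greatest) auto
  then have "?N * (emeasure M (space M) / ?N) \<le> ?N * Cat_upto F (transverse_measure \<U> M) n \<U>"
    by (rule mult_left_mono) simp
  then show ?thesis
    using N by (simp add: ennreal_times_divide ennreal_mult_divide_eq mult.commute[of ?N])
qed

end

section \<open>The vanishing measure\<close>

lemma INF_zero_or_top:
  fixes f :: "'a \<Rightarrow> ennreal"
  assumes "\<And>x. x \<in> A \<Longrightarrow> f x = 0 \<or> f x = \<infinity>"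
  shows "(INF x\<in>A. f x) = 0 \<or> (INF x\<in>A. f x) = \<infinity>"
proof (cases "\<exists>x\<in>A. f x = 0")
  case True
  then show ?thesis by (metis INF_lower le_zero_eq)
next
  case False
  then have "(INF x\<in>A. f x) = \<infinity>"
    using assms by (auto simp: infinity_ennreal_def intro!: antisym INF_greatest)
  then show ?thesis ..
qed

lemma infsum_zero_or_top:
  fixes f :: "'a \<Rightarrow> ennreal"
  assumes "\<And>x. x \<in> A \<Longrightarrow> f x = 0 \<or> f x = \<infinity>"
  shows "infsum f A = 0 \<or> infsum f A = \<infinity>"
proof (cases "\<exists>x\<in>A. f x = \<infinity>")
  case True
  then obtain x where x: "x \<in> A" "f x = \<infinity>" by blast
  have "sum f {x} \<le> infsum f A"
    using x(1) by (subst nonneg_infsum_complete) (simp, intro SUP_upper, simp)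
  then show ?thesis using x by (simp add: top_unique)
next
  case False
  then show ?thesis using assms infsum_0 by metis
qed

lemma Cat_upto_null_measure:
  assumes "emeasure M (space M) = 0"
  shows "Cat_upto F (transverse_measure \<U> M) n \<U> = 0
    \<or> Cat_upto F (transverse_measure \<U> M) n \<U> = \<infinity>"
proof -
  have "emeasure M E = 0" for E
    using assms emeasure_space[of M E] by simp
  then have "transverse_measure \<U> M Q = 0 \<or> transverse_measure \<U> M Q = \<infinity>" for Q
    unfolding transverse_measure_def by (intro INF_zero_or_top) auto
  then show ?thesis
    unfolding Cat_upto_def category_via_def
    by (intro INF_zero_or_top infsum_zero_or_top)
qed

section \<open>Growth types\<close>

lemma growth_type_le_self:
  assumes "growth_function g" "growth_function h" "growth_dominated g h"
  shows "growth_type_le (growth_type g) (growth_type h)"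
proof -
  have refl: "growth_dominated f f" for f
    unfolding growth_dominated_def by (intro exI[of _ 1] conjI) auto
  then show ?thesis
    unfolding growth_type_le_def growth_type_def using assms by blast
qed

lemma category_via_antimono:
  assumes sub: "\<And>U. C U \<subseteq> D U"
  shows "category_via D \<Lambda> \<le> category_via C \<Lambda>"
  unfolding category_via_def
proof (rule INF_superset_mono)
  have ne: "D U \<noteq> {}" if "C U \<noteq> {}" for U
    using sub[of U] that by auto
  show "{\<V>. \<Union>\<V> = UNIV \<and> (\<forall>U\<in>\<V>. open U \<and> C U \<noteq> {})}
      \<subseteq> {\<V>. \<Union>\<V> = UNIV \<and> (\<forall>U\<in>\<V>. open U \<and> D U \<noteq> {})}"
    by (rule Collect_mono) (simp add: ne)
  show "(\<Sum>\<^sub>\<infinity>U\<in>\<V>. (INF H\<in>D U. \<Lambda> (H ` (U \<times> {1}))))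
      \<le> (\<Sum>\<^sub>\<infinity>U\<in>\<V>. (INF H\<in>C U. \<Lambda> (H ` (U \<times> {1}))))" for \<V>
    by (intro infsum_mono nonneg_summable_on_complete INF_superset_mono sub) auto
qed

lemma Cat_upto_antimono:
  assumes "m \<le> n"
  shows "Cat_upto F \<Lambda> n \<U> \<le> Cat_upto F \<Lambda> m \<U>"
  unfolding Cat_upto_def
proof (rule category_via_antimono)
  show "{H \<in> tangential_contractions F U. deformation_length \<U> U H \<le> enat m}
      \<subseteq> {H \<in> tangential_contractions F U. deformation_length \<U> U H \<le> enat n}" for U
    using assms by (auto intro: order_trans)
qed

lemma ennreal_reciprocal_antimono:
  fixes a b :: ennreal
  assumes "a \<le> b"
  shows "1 / b \<le> 1 / a"
  using assms
  by (cases a; cases b; cases "a = 0")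
     (auto simp: divide_ennreal frac_le ennreal_1[symmetric] top_unique simp del: ennreal_1)

lemma Cat_upto_growth_function:
  assumes "\<And>n. n \<ge> 1 \<Longrightarrow> 0 < Cat_upto F \<Lambda> n \<U>"
  shows "growth_function (\<lambda>n. enn2real (1 / Cat_upto F \<Lambda> n \<U>))"
  unfolding growth_function_def
proof (intro conjI allI impI)
  fix m n :: nat
  assume m: "m \<ge> 1" and mn: "m \<le> n"
  have "1 / Cat_upto F \<Lambda> m \<U> \<le> 1 / Cat_upto F \<Lambda> n \<U>"
    by (intro ennreal_reciprocal_antimono Cat_upto_antimono mn)
  moreover have "1 / Cat_upto F \<Lambda> n \<U> < top"
    using assms[of n] m mn by (simp add: top.not_eq_extremum[symmetric] ennreal_divide_eq_top_iff)
  ultimately show "enn2real (1 / Cat_upto F \<Lambda> m \<U>) \<le> enn2real (1 / Cat_upto F \<Lambda> n \<U>)"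
    by (rule enn2real_mono)
qed simp

lemma compositions_growth_function:
  assumes "finite S"
  shows "growth_function (\<lambda>n. real (card (compositions_upto S n)))"
  unfolding growth_function_def
  by (auto intro!: card_mono finite_compositions_upto compositions_upto_mono assms)

text \<open>The constant has to be the same for all \<open>C\<close> and \<open>N\<close>; it is \<open>1 / m\<close>, or anything
  positive if \<open>m\<close> is infinite.\<close>

lemma enn2real_reciprocal_le:
  fixes m :: ennreal
  assumes m: "0 < m"
  shows "\<exists>A>0. \<forall>C N. m \<le> of_nat N * C \<longrightarrow> enn2real (1 / C) \<le> A * real N"
proof (cases m)
  case (real r)
  then have r: "r > 0" using m by simp
  have "enn2real (1 / C) \<le> 1 / r * real N" if le: "m \<le> of_nat N * C" for C N
  proof (cases C)
    case (real c)
    have "ennreal r \<le> ennreal (real N * c)"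
      using le \<open>m = ennreal r\<close> real by (simp add: ennreal_mult ennreal_of_nat_eq_real_of_nat)
    then have rc: "r \<le> real N * c"
      using real by (simp add: ennreal_le_iff)
    then have c: "c > 0" using r real by (cases "c = 0") auto
    have "1 / C = ennreal (1 / c)"
      using real c divide_ennreal[of 1 c] by simp
    moreover have "1 / c \<le> 1 / r * real N"
      using rc c r by (simp add: field_simps)
    ultimately show ?thesis using c by simp
  qed (use r in simp)
  then show ?thesis using r by (intro exI[of _ "1 / r"]) simp
next
  case top
  \<comment> \<open>A natural multiple of \<open>C\<close> is infinite only if \<open>C\<close> is, and then \<open>1 / C = 0\<close>.\<close>
  have "enn2real (1 / C) \<le> 1 * real N" if "m \<le> of_nat N * C" for C N
  proof -
    have "C = top" using that top by (auto simp: top_unique ennreal_mult_eq_top_iff)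
    then show ?thesis by simp
  qed
  then show ?thesis by (intro exI[of _ 1]) simp
qed

theorem proposition5p3:
  fixes F \<U> :: "('x::polish_space, 'e::euclidean_space) chart set"
    and M :: "('x, 'e) tpoint measure"
  assumes "compact (UNIV :: 'x set)"
    and "lamination F"
    and "regular_atlas F \<U>" and "finite \<U>"
    and "transverse_invariant_measure \<U> M"
    and "regular_measure (transverse_space \<U>) M"
    and "finite_on_compacts (transverse_space \<U>) M"
    and "Cat F (transverse_measure \<U> M) = 0"
    and "\<And>n. n \<ge> 1 \<Longrightarrow> 0 < Cat_upto F (transverse_measure \<U> M) n \<U>"
  shows "growth_type_le
           (Cat_II F (transverse_measure \<U> M) \<U>)
           (measure_growth (transverse_space \<U>) (holonomy_generators \<U>) M)"
proof -
  interpret holonomy_measure F \<U> M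
    using assms by unfold_locales auto
  let ?N = "\<lambda>n. card (compositions_upto S\<^sub>K n)"
  let ?Cat = "\<lambda>n. Cat_upto F (transverse_measure \<U> M) n \<U>"
  have "\<exists>A>0. \<forall>n\<ge>1. enn2real (1 / ?Cat n) \<le> A * real (?N n)"
  proof (cases "emeasure M (space M) = 0")
    case True
    have "?Cat n = \<infinity>" if "n \<ge> 1" for n
      using Cat_upto_null_measure[OF True, of F \<U> n] assms(9)[OF that] by auto
    then show ?thesis by (intro exI[of _ 1]) auto
  next
    case False
    then have "0 < emeasure M (space M)" by (simp add: zero_less_iff_neq_zero)
    then show ?thesis
      using enn2real_reciprocal_le total_mass_le[OF assms(1)] by meson
  qed
  then have "growth_dominated (\<lambda>n. enn2real (1 / ?Cat n)) (\<lambda>n. real (?N n))"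
    unfolding growth_dominated_def by (intro exI[of _ 1]) simp
  then show ?thesis
    unfolding Cat_II_def measure_growth_def pseudogroup_growth_def
    by (intro growth_type_le_self Cat_upto_growth_function compositions_growth_function
        finite_induced_generators assms(9))
qed

end
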